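(* For every natural number $k$ and every formula $\varphi$: (1) $\varphi \in \mathrm{E}_k^+$ if and only if $\mathrm{PNF}(\varphi) \cap \Sigma_k^+ \neq \emptyset$. (2) $\varphi \in \mathrm{U}_k^+$ if and only if $\mathrm{PNF}(\varphi) \cap \Pi_k^+ \neq \emptyset$. (3) $\varphi \in \mathrm{F}_k^+$ if and only if $\mathrm{PNF}(\varphi) \cap \Sigma_{k+1}^+ \neq \emptyset$ and $\mathrm{PNF}(\varphi) \cap \Pi_{k+1}^+ \neq \emptyset$. (4) $\varphi \in \mathrm{E}_{k+1}$ if and only if $\mathrm{PNF}(\varphi) \cap \Sigma_{k+1}^+ \neq \emptyset$ and $\mathrm{PNF}(\varphi) \cap \Pi_{k+1}^+ = \emptyset$; equivalently, if and only if $\mathrm{PNF}(\varphi) \cap \Sigma_{k+1} \neq \emptyset$ and $\mathrm{PNF}(\varphi) \cap \Pi_{k+1}^+ = \emptyset$. (5) $\varphi \in \mathrm{U}_{k+1}$ if and only if $\mathrm{PNF}(\varphi) \cap \Pi_{k+1}^+ \neq \emptyset$ and $\mathrm{PNF}(\varphi) \cap \Sigma_{k+1}^+ = \emptyset$; equivalently, if and only if $\mathrm{PNF}(\varphi) \cap \Pi_{k+1} \neq \emptyset$ and $\mathrm{PNF}(\varphi) \cap \Sigma_{k+1}^+ = \emptyset$. (6) $\varphi \in \mathrm{PF}_k$ if and only if $\mathrm{PNF}(\varphi) \cap \Sigma_{k+1}^+ \neq \emptyset$, $\mathrm{PNF}(\varphi) \cap \Pi_{k+1}^+ \neq \emptyset$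 and $\mathrm{PNF}(\varphi) \cap (\Sigma_k^+ \cup \Pi_k^+) = \emptyset$; equivalently, if and only if $\mathrm{PNF}(\varphi) \cap \Sigma_{k+1} \neq \emptyset$, $\mathrm{PNF}(\varphi) \cap \Pi_{k+1} \neq \emptyset$ and $\mathrm{PNF}(\varphi) \cap (\Sigma_k^+ \cup \Pi_k^+) = \emptyset$.
   Context: Fix an arbitrary first-order language whose logical symbols are $\forall, \exists, \to, \land, \lor, \perp$ ($\neg\varphi$ abbreviates $\varphi \to \perp$). All formulas are formulas of this language; $\mathrm{FV}(\varphi)$ is the set of free variables of $\varphi$. Prenex classes: $\Sigma_0 = \Pi_0$ is the class of quantifier-free formulas; $\Sigma_{k+1}$ is the class of formulas $\exists x_1 \cdots \exists x_n \varphi$ with $n \geq 1$ and $\varphi \in \Pi_k$; $\Pi_{k+1}$ is the class of formulas $\forall x_1 \cdots \forall x_n \varphi$ with $n\ge 1$ and $\varphi \in \Sigma_k$. Cumulative versions: $\Sigma_k^+ = \Sigma_k \cup \bigcup_{i<k}(\Sigma_i \cup \Pi_i)$ and $\Pi_k^+ = \Pi_k \cup \bigcup_{i<k}(\Sigma_i \cup \Pi_i)$. A formula is in prenex normal form if it is in $\Sigma_k \cup \Pi_k$ for some $k$. Alternation paths: an alternation path is a finite sequence of the symbols $+$ and $-$ in which $+$ and $-$ alternate. For an alternation path $s$, $i(s)$ is the first symbol of $s$ if $s$ is nonempty and a special symbol $\times$ if $s = \langle\,\rangle$; $s^\perp$ is obtained by swapping $+$ and $-$ in $s$; $l(s)$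 is the length of $s$; $+s$, $-s$ denote prepending a symbol. The set $\mathrm{Alt}(\varphi)$: if $\varphi$ is quantifier-free, $\mathrm{Alt}(\varphi) = \{\langle\,\rangle\}$; otherwise inductively $\mathrm{Alt}(\varphi_1 \land \varphi_2) = \mathrm{Alt}(\varphi_1\lor\varphi_2) = \mathrm{Alt}(\varphi_1) \cup \mathrm{Alt}(\varphi_2)$; $\mathrm{Alt}(\varphi_1 \to \varphi_2) = \{s^\perp : s \in \mathrm{Alt}(\varphi_1)\} \cup \mathrm{Alt}(\varphi_2)$; $\mathrm{Alt}(\forall x \varphi_1) = \{s \in \mathrm{Alt}(\varphi_1) : i(s) = -\} \cup \{-s : s \in \mathrm{Alt}(\varphi_1),\ i(s) \neq -\}$; $\mathrm{Alt}(\exists x \varphi_1) = \{s \in \mathrm{Alt}(\varphi_1) : i(s) = +\} \cup \{+s : s \in \mathrm{Alt}(\varphi_1),\ i(s) \neq +\}$. The degree is $\deg(\varphi) = \max\{l(s) : s \in \mathrm{Alt}(\varphi)\}$. Classes: $\mathrm{F}_k = \{\varphi : \deg(\varphi) = k\}$; $\mathrm{F}_k^+ = \{\varphi : \deg(\varphi) \le k\}$; $\mathrm{U}_0 = \mathrm{E}_0 = \mathrm{F}_0$; $\mathrm{U}_{k+1} = \{\varphi \in \mathrm{F}_{k+1} : i(s) = - \text{ for all } s \in \mathrm{Alt}(\varphi) \text{ with } l(s) = k+1\}$; $\mathrm{E}_{k+1} = \{\varphi \in \mathrm{F}_{k+1} : i(s) = + \text{ for all } s \in \mathrm{Alt}(\varphi)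 \text{ with } l(s) = k+1\}$; $\mathrm{PF}_k = \mathrm{F}_k \setminus (\mathrm{E}_k \cup \mathrm{U}_k)$ (so $\mathrm{PF}_0 = \emptyset$); $\mathrm{U}_k^+ = \mathrm{U}_k \cup \bigcup_{i<k}\mathrm{F}_i$; $\mathrm{E}_k^+ = \mathrm{E}_k \cup \bigcup_{i<k}\mathrm{F}_i$. Prenex transformation: $\varphi \rhd \psi$ means that for some formulas $\xi,\delta$, a variable $x \notin \mathrm{FV}(\delta)$, a variable $y$ not occurring in $\xi$, and $Q \in \{\forall,\exists\}$, the pair $(\varphi,\psi)$ is one of: $(\exists x\xi(x) \to \delta,\ \forall x(\xi(x)\to\delta))$; $(\forall x\xi(x)\to\delta,\ \exists x(\xi(x)\to\delta))$; $(\delta \to Qx\,\xi(x),\ Qx(\delta\to\xi(x)))$; $(Qx\,\xi(x)\land\delta,\ Qx(\xi(x)\land\delta))$; $(\delta\land Qx\,\xi(x),\ Qx(\delta\land\xi(x)))$; $(Qx\,\xi(x)\lor\delta,\ Qx(\xi(x)\lor\delta))$; $(\delta\lor Qx\,\xi(x),\ Qx(\delta\lor\xi(x)))$; $(Qx\,\xi(x),\ Qy\,\xi(y))$, where $\xi(y)$ is $\xi(x)$ with $y$ substituted for the free occurrences of $x$. $\varphi \rhd^* \psi$ means there are $m \ge 0$ and formulas $\varphi_0 \equiv \varphi, \varphi_1, \dots, \varphi_m \equiv \psi$ such that for each $i<m$, $\varphi_{i+1}$ is obtained from $\varphi_i$ by replacing one occurrence of a subformula $\xi_i$ by a formula $\delta_i$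 with $\xi_i \rhd \delta_i$. Finally $\mathrm{PNF}(\varphi) = \{\psi : \varphi \rhd^* \psi \text{ and } \psi \text{ is in prenex normal form}\}$. *)

theory Defs
  imports Main
begin

datatype 'f trm = Var nat | Fn 'f "'f trm list"

datatype ('f, 'p) fm =
    Bot
  | Rel 'p "'f trm list"
  | Imp "('f, 'p) fm" "('f, 'p) fm"
  | Conj "('f, 'p) fm" "('f, 'p) fm"
  | Disj "('f, 'p) fm" "('f, 'p) fm"
  | All nat "('f, 'p) fm"
  | Ex nat "('f, 'p) fm"

text \<open>
  A language is given by its function and relation symbols, each paired with its arity;
  either set may be empty. Equality, if present, is one of the binary relation symbols.
  The types \<open>trm\<close> and \<open>fm\<close> ignore arities; the formulas of the language \<open>L\<close> are the
  elements of \<open>formulas L\<close>.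
\<close>

record ('f, 'p) language =
  funs :: "('f \<times> nat) set"
  rels :: "('p \<times> nat) set"

fun wf_trm :: "('f, 'p) language \<Rightarrow> 'f trm \<Rightarrow> bool" where
  "wf_trm L (Var x) \<longleftrightarrow> True"
| "wf_trm L (Fn f ts) \<longleftrightarrow> (f, length ts) \<in> funs L \<and> (\<forall>t\<in>set ts. wf_trm L t)"

fun wf_fm :: "('f, 'p) language \<Rightarrow> ('f, 'p) fm \<Rightarrow> bool" where
  "wf_fm L Bot \<longleftrightarrow> True"
| "wf_fm L (Rel p ts) \<longleftrightarrow> (p, length ts) \<in> rels L \<and> (\<forall>t\<in>set ts. wf_trm L t)"
| "wf_fm L (Imp \<phi> \<psi>) \<longleftrightarrow> wf_fm L \<phi> \<and> wf_fm L \<psi>"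
| "wf_fm L (Conj \<phi> \<psi>) \<longleftrightarrow> wf_fm L \<phi> \<and> wf_fm L \<psi>"
| "wf_fm L (Disj \<phi> \<psi>) \<longleftrightarrow> wf_fm L \<phi> \<and> wf_fm L \<psi>"
| "wf_fm L (All x \<phi>) \<longleftrightarrow> wf_fm L \<phi>"
| "wf_fm L (Ex x \<phi>) \<longleftrightarrow> wf_fm L \<phi>"

definition formulas :: "('f, 'p) language \<Rightarrow> ('f, 'p) fm set" where
  "formulas L = {\<phi>. wf_fm L \<phi>}"

fun vars_trm :: "'f trm \<Rightarrow> nat set" where
  "vars_trm (Var x) = {x}"
| "vars_trm (Fn f ts) = (\<Union>t\<in>set ts. vars_trm t)"

fun FV :: "('f, 'p) fm \<Rightarrow> nat set" where
  "FV Bot = {}"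
| "FV (Rel p ts) = (\<Union>t\<in>set ts. vars_trm t)"
| "FV (Imp \<phi> \<psi>) = FV \<phi> \<union> FV \<psi>"
| "FV (Conj \<phi> \<psi>) = FV \<phi> \<union> FV \<psi>"
| "FV (Disj \<phi> \<psi>) = FV \<phi> \<union> FV \<psi>"
| "FV (All x \<phi>) = FV \<phi> - {x}"
| "FV (Ex x \<phi>) = FV \<phi> - {x}"

text \<open>All variables occurring in a formula: free, bound, or merely next to a quantifier.\<close>

fun vars_fm :: "('f, 'p) fm \<Rightarrow> nat set" where
  "vars_fm Bot = {}"
| "vars_fm (Rel p ts) = (\<Union>t\<in>set ts. vars_trm t)"
| "vars_fm (Imp \<phi> \<psi>) = vars_fm \<phi> \<union> vars_fm \<psi>"
| "vars_fm (Conj \<phi> \<psi>) = vars_fm \<phi> \<union> vars_fm \<psi>"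
| "vars_fm (Disj \<phi> \<psi>) = vars_fm \<phi> \<union> vars_fm \<psi>"
| "vars_fm (All x \<phi>) = insert x (vars_fm \<phi>)"
| "vars_fm (Ex x \<phi>) = insert x (vars_fm \<phi>)"

text \<open>
  \<open>subst_fm x y \<phi>\<close> puts \<open>y\<close> for the free occurrences of \<open>x\<close>. Capture is not avoided here;
  it cannot happen below, where \<open>y\<close> does not occur in \<open>\<phi>\<close>.
\<close>

fun subst_trm :: "nat \<Rightarrow> nat \<Rightarrow> 'f trm \<Rightarrow> 'f trm" where
  "subst_trm x y (Var z) = Var (if z = x then y else z)"
| "subst_trm x y (Fn f ts) = Fn f (map (subst_trm x y) ts)"

fun subst_fm :: "nat \<Rightarrow> nat \<Rightarrow> ('f, 'p) fm \<Rightarrow> ('f, 'p) fm" where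
  "subst_fm x y Bot = Bot"
| "subst_fm x y (Rel p ts) = Rel p (map (subst_trm x y) ts)"
| "subst_fm x y (Imp \<phi> \<psi>) = Imp (subst_fm x y \<phi>) (subst_fm x y \<psi>)"
| "subst_fm x y (Conj \<phi> \<psi>) = Conj (subst_fm x y \<phi>) (subst_fm x y \<psi>)"
| "subst_fm x y (Disj \<phi> \<psi>) = Disj (subst_fm x y \<phi>) (subst_fm x y \<psi>)"
| "subst_fm x y (All z \<phi>) = All z (if z = x then \<phi> else subst_fm x y \<phi>)"
| "subst_fm x y (Ex z \<phi>) = Ex z (if z = x then \<phi> else subst_fm x y \<phi>)"

fun qfree :: "('f, 'p) fm \<Rightarrow> bool" where
  "qfree Bot \<longleftrightarrow> True"
| "qfree (Rel p ts) \<longleftrightarrow> True"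
| "qfree (Imp \<phi> \<psi>) \<longleftrightarrow> qfree \<phi> \<and> qfree \<psi>"
| "qfree (Conj \<phi> \<psi>) \<longleftrightarrow> qfree \<phi> \<and> qfree \<psi>"
| "qfree (Disj \<phi> \<psi>) \<longleftrightarrow> qfree \<phi> \<and> qfree \<psi>"
| "qfree (All x \<phi>) \<longleftrightarrow> False"
| "qfree (Ex x \<phi>) \<longleftrightarrow> False"

fun Sigma_cls :: "nat \<Rightarrow> ('f, 'p) fm set" and Pi_cls :: "nat \<Rightarrow> ('f, 'p) fm set" where
  "Sigma_cls 0 = {\<phi>. qfree \<phi>}"
| "Pi_cls 0 = {\<phi>. qfree \<phi>}"
| "Sigma_cls (Suc k) = {foldr Ex xs \<phi> |xs \<phi>. xs \<noteq> [] \<and> \<phi> \<in> Pi_cls k}"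
| "Pi_cls (Suc k) = {foldr All xs \<phi> |xs \<phi>. xs \<noteq> [] \<and> \<phi> \<in> Sigma_cls k}"

definition Sigma_plus :: "nat \<Rightarrow> ('f, 'p) fm set" where
  "Sigma_plus k = Sigma_cls k \<union> (\<Union>i<k. Sigma_cls i \<union> Pi_cls i)"

definition Pi_plus :: "nat \<Rightarrow> ('f, 'p) fm set" where
  "Pi_plus k = Pi_cls k \<union> (\<Union>i<k. Sigma_cls i \<union> Pi_cls i)"

definition prenex :: "('f, 'p) fm \<Rightarrow> bool" where
  "prenex \<phi> \<longleftrightarrow> (\<exists>k. \<phi> \<in> Sigma_cls k \<union> Pi_cls k)"

datatype sign = Plus | Minus

fun flip :: "sign \<Rightarrow> sign" where
  "flip Plus = Minus"
| "flip Minus = Plus"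

definition alternation_path :: "sign list \<Rightarrow> bool" where
  "alternation_path s \<longleftrightarrow> (\<forall>j. Suc j < length s \<longrightarrow> s ! j \<noteq> s ! Suc j)"

definition perp :: "sign list \<Rightarrow> sign list" where
  "perp s = map flip s"

text \<open>\<open>None\<close> is the special symbol \<open>\<times>\<close>.\<close>

fun initial :: "sign list \<Rightarrow> sign option" where
  "initial [] = None"
| "initial (a # s) = Some a"

text \<open>
  The clause for quantifier-free formulas is stated for atomic formulas only; for the others
  it follows (lemma \<open>Alt_qfree\<close>).
\<close>

fun Alt :: "('f, 'p) fm \<Rightarrow> sign list set" where
  "Alt Bot = {[]}"
| "Alt (Rel p ts) = {[]}"
| "Alt (Imp \<phi> \<psi>) = {perp s |s. s \<in> Alt \<phi>} \<union> Alt \<psi>"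
| "Alt (Conj \<phi> \<psi>) = Alt \<phi> \<union> Alt \<psi>"
| "Alt (Disj \<phi> \<psi>) = Alt \<phi> \<union> Alt \<psi>"
| "Alt (All x \<phi>) = {s \<in> Alt \<phi>. initial s = Some Minus}
      \<union> {Minus # s |s. s \<in> Alt \<phi> \<and> initial s \<noteq> Some Minus}"
| "Alt (Ex x \<phi>) = {s \<in> Alt \<phi>. initial s = Some Plus}
      \<union> {Plus # s |s. s \<in> Alt \<phi> \<and> initial s \<noteq> Some Plus}"

lemma Alt_qfree: "qfree \<phi> \<Longrightarrow> Alt \<phi> = {[]}"
  by (induction \<phi>) (auto simp: perp_def)

lemma finite_Alt: "finite (Alt \<phi>)"
  by (induction \<phi>) auto

lemma Alt_nonempty: "Alt \<phi> \<noteq> {}"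
  by (induction \<phi>) auto

lemma alternation_path_Alt: "s \<in> Alt \<phi> \<Longrightarrow> alternation_path s"
proof (induction \<phi> arbitrary: s)
  case (Imp \<phi> \<psi>)
  have flip_eq: "flip a = flip b \<longleftrightarrow> a = b" for a b
    by (cases a; cases b) auto
  show ?case
    using Imp by (auto simp: alternation_path_def perp_def flip_eq)
next
  case (All x \<phi>)
  have "alternation_path (Minus # t)" if "alternation_path t" "initial t \<noteq> Some Minus" for t
    using that by (cases t) (auto simp: alternation_path_def nth_Cons split: nat.splits)
  with All show ?case by auto
next
  case (Ex x \<phi>)
  have "alternation_path (Plus # t)" if "alternation_path t" "initial t \<noteq> Some Plus" for t
    using that by (cases t) (auto simp: alternation_path_def nth_Cons split: nat.splits)
  with Ex show ?case by auto
qed (auto simp: alternation_path_def)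

definition deg :: "('f, 'p) fm \<Rightarrow> nat" where
  "deg \<phi> = Max {length s |s. s \<in> Alt \<phi>}"

definition F_cls :: "nat \<Rightarrow> ('f, 'p) fm set" where
  "F_cls k = {\<phi>. deg \<phi> = k}"

definition F_plus :: "nat \<Rightarrow> ('f, 'p) fm set" where
  "F_plus k = {\<phi>. deg \<phi> \<le> k}"

fun U_cls :: "nat \<Rightarrow> ('f, 'p) fm set" where
  "U_cls 0 = F_cls 0"
| "U_cls (Suc k) = {\<phi> \<in> F_cls (Suc k).
      \<forall>s \<in> Alt \<phi>. length s = Suc k \<longrightarrow> initial s = Some Minus}"

fun E_cls :: "nat \<Rightarrow> ('f, 'p) fm set" where
  "E_cls 0 = F_cls 0"
| "E_cls (Suc k) = {\<phi> \<in> F_cls (Suc k).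
      \<forall>s \<in> Alt \<phi>. length s = Suc k \<longrightarrow> initial s = Some Plus}"

definition PF_cls :: "nat \<Rightarrow> ('f, 'p) fm set" where
  "PF_cls k = F_cls k - (E_cls k \<union> U_cls k)"

definition U_plus :: "nat \<Rightarrow> ('f, 'p) fm set" where
  "U_plus k = U_cls k \<union> (\<Union>i<k. F_cls i)"

definition E_plus :: "nat \<Rightarrow> ('f, 'p) fm set" where
  "E_plus k = E_cls k \<union> (\<Union>i<k. F_cls i)"

inductive rhd :: "('f, 'p) fm \<Rightarrow> ('f, 'p) fm \<Rightarrow> bool" (infix "\<rhd>" 50) where
  Ex_Imp: "x \<notin> FV \<delta> \<Longrightarrow> Imp (Ex x \<xi>) \<delta> \<rhd> All x (Imp \<xi> \<delta>)"
| All_Imp: "x \<notin> FV \<delta> \<Longrightarrow> Imp (All x \<xi>) \<delta> \<rhd> Ex x (Imp \<xi> \<delta>)"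
| Imp_Q: "Q \<in> {All, Ex} \<Longrightarrow> x \<notin> FV \<delta> \<Longrightarrow> Imp \<delta> (Q x \<xi>) \<rhd> Q x (Imp \<delta> \<xi>)"
| Q_Conj: "Q \<in> {All, Ex} \<Longrightarrow> x \<notin> FV \<delta> \<Longrightarrow> Conj (Q x \<xi>) \<delta> \<rhd> Q x (Conj \<xi> \<delta>)"
| Conj_Q: "Q \<in> {All, Ex} \<Longrightarrow> x \<notin> FV \<delta> \<Longrightarrow> Conj \<delta> (Q x \<xi>) \<rhd> Q x (Conj \<delta> \<xi>)"
| Q_Disj: "Q \<in> {All, Ex} \<Longrightarrow> x \<notin> FV \<delta> \<Longrightarrow> Disj (Q x \<xi>) \<delta> \<rhd> Q x (Disj \<xi> \<delta>)"
| Disj_Q: "Q \<in> {All, Ex} \<Longrightarrow> x \<notin> FV \<delta> \<Longrightarrow> Disj \<delta> (Q x \<xi>) \<rhd> Q x (Disj \<delta> \<xi>)"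
| Q_rename: "Q \<in> {All, Ex} \<Longrightarrow> y \<notin> vars_fm \<xi> \<Longrightarrow> Q x \<xi> \<rhd> Q y (subst_fm x y \<xi>)"

text \<open>Replacement of one occurrence of a subformula \<open>\<xi>\<close> by some \<open>\<delta>\<close> with \<open>\<xi> \<rhd> \<delta>\<close>.\<close>

inductive rhd_step :: "('f, 'p) fm \<Rightarrow> ('f, 'p) fm \<Rightarrow> bool" where
  here: "\<phi> \<rhd> \<psi> \<Longrightarrow> rhd_step \<phi> \<psi>"
| Imp_left: "rhd_step \<phi> \<phi>' \<Longrightarrow> rhd_step (Imp \<phi> \<psi>) (Imp \<phi>' \<psi>)"
| Imp_right: "rhd_step \<psi> \<psi>' \<Longrightarrow> rhd_step (Imp \<phi> \<psi>) (Imp \<phi> \<psi>')"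
| Conj_left: "rhd_step \<phi> \<phi>' \<Longrightarrow> rhd_step (Conj \<phi> \<psi>) (Conj \<phi>' \<psi>)"
| Conj_right: "rhd_step \<psi> \<psi>' \<Longrightarrow> rhd_step (Conj \<phi> \<psi>) (Conj \<phi> \<psi>')"
| Disj_left: "rhd_step \<phi> \<phi>' \<Longrightarrow> rhd_step (Disj \<phi> \<psi>) (Disj \<phi>' \<psi>)"
| Disj_right: "rhd_step \<psi> \<psi>' \<Longrightarrow> rhd_step (Disj \<phi> \<psi>) (Disj \<phi> \<psi>')"
| All_body: "rhd_step \<phi> \<phi>' \<Longrightarrow> rhd_step (All x \<phi>) (All x \<phi>')"
| Ex_body: "rhd_step \<phi> \<phi>' \<Longrightarrow> rhd_step (Ex x \<phi>) (Ex x \<phi>')"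

definition rhd_star :: "('f, 'p) language \<Rightarrow> ('f, 'p) fm \<Rightarrow> ('f, 'p) fm \<Rightarrow> bool" where
  "rhd_star L = (\<lambda>\<phi> \<psi>. \<phi> \<in> formulas L \<and> \<psi> \<in> formulas L \<and> rhd_step \<phi> \<psi>)\<^sup>*\<^sup>*"

definition PNF :: "('f, 'p) language \<Rightarrow> ('f, 'p) fm \<Rightarrow> ('f, 'p) fm set" where
  "PNF L \<phi> = {\<psi>. rhd_star L \<phi> \<psi> \<and> prenex \<psi>}"

end

theory Submission
  imports Defs
begin

text \<open>
  Membership in \<open>E_plus k\<close> and \<open>U_plus k\<close> only bounds the length of every alternation path
  by \<open>k\<close> and prescribes the first sign of the paths of length \<open>k\<close>. This bound has a
  compositional description, and it is reflected by every prenex step, because pulling a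
  quantifier over a side formula can only lengthen paths. A prenex formula satisfies the bound
  iff it lies in \<open>Sigma_plus k\<close>, respectively \<open>Pi_plus k\<close>. Conversely, the bound is preserved
  if quantifiers are pulled out greedily: first all of the prescribed kind, and when none is
  left at the front, all of the other kind, with the bound lowered by one. The remaining items
  are Boolean combinations of the first two.
\<close>

section \<open>Sign-indexed vocabulary\<close>

definition path_bounded :: "sign \<Rightarrow> nat \<Rightarrow> sign list \<Rightarrow> bool" where
  "path_bounded \<sigma> k s \<longleftrightarrow> length s < k \<or> length s = k \<and> (k = 0 \<or> initial s = Some \<sigma>)"

definition alt_bounded :: "sign \<Rightarrow> nat \<Rightarrow> ('f, 'p) fm \<Rightarrow> bool" where
  "alt_bounded \<sigma> k \<phi> \<longleftrightarrow> (\<forall>s\<in>Alt \<phi>. path_bounded \<sigma> k s)"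

text \<open>Naming quantifiers by their path symbol lets each pair of dual arguments be given
  once.\<close>

fun quant :: "sign \<Rightarrow> nat \<Rightarrow> ('f, 'p) fm \<Rightarrow> ('f, 'p) fm" where
  "quant Plus = Ex"
| "quant Minus = All"

datatype binop = OpImp | OpConj | OpDisj

fun bin :: "binop \<Rightarrow> ('f, 'p) fm \<Rightarrow> ('f, 'p) fm \<Rightarrow> ('f, 'p) fm" where
  "bin OpImp = Imp"
| "bin OpConj = Conj"
| "bin OpDisj = Disj"

text \<open>The kind of quantifier on the left of the connective that is pulled out as \<open>\<sigma>\<close>.\<close>

fun left_sign :: "binop \<Rightarrow> sign \<Rightarrow> sign" where
  "left_sign OpImp \<sigma> = flip \<sigma>"
| "left_sign _ \<sigma> = \<sigma>"

text \<open>Prenex form without a hierarchy level; \<open>prefix_plus_iff\<close> ties it to the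
  classes.\<close>

fun prenex_shape :: "('f, 'p) fm \<Rightarrow> bool" where
  "prenex_shape (All x \<phi>) \<longleftrightarrow> prenex_shape \<phi>"
| "prenex_shape (Ex x \<phi>) \<longleftrightarrow> prenex_shape \<phi>"
| "prenex_shape \<phi> \<longleftrightarrow> qfree \<phi>"

text \<open>Induction measure that, unlike the subformula order, survives renaming of bound
  variables.\<close>

fun quant_count :: "('f, 'p) fm \<Rightarrow> nat" where
  "quant_count (Imp \<phi> \<psi>) = quant_count \<phi> + quant_count \<psi>"
| "quant_count (Conj \<phi> \<psi>) = quant_count \<phi> + quant_count \<psi>"
| "quant_count (Disj \<phi> \<psi>) = quant_count \<phi> + quant_count \<psi>"
| "quant_count (All x \<phi>) = Suc (quant_count \<phi>)"
| "quant_count (Ex x \<phi>) = Suc (quant_count \<phi>)"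
| "quant_count _ = 0"


section \<open>Bounded alternation\<close>

lemma flip_flip [simp]: "flip (flip \<sigma>) = \<sigma>"
  by (cases \<sigma>) auto

lemma flip_neq [simp]: "flip \<sigma> \<noteq> \<sigma>" "\<sigma> \<noteq> flip \<sigma>"
  by (cases \<sigma>; simp)+

lemma sign_eq_or_flip: "\<tau> = \<sigma> \<or> \<tau> = flip \<sigma>"
  by (cases \<sigma>; cases \<tau>) auto

lemma left_sign_flip: "left_sign f (flip \<sigma>) = flip (left_sign f \<sigma>)"
  by (cases f) auto

lemma path_bounded_perp [simp]: "path_bounded \<sigma> k (perp s) \<longleftrightarrow> path_bounded (flip \<sigma>) k s"
proof (cases s)
  case (Cons a t)
  then show ?thesis
    by (cases a; cases \<sigma>) (auto simp: path_bounded_def perp_def)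
qed (simp add: path_bounded_def perp_def)

text \<open>A path within level \<open>k\<close> is strictly shorter than \<open>Suc k\<close>, and
  shorter paths carry no sign condition, so the sign may change freely.\<close>

lemma path_bounded_Suc: "path_bounded \<sigma> k s \<Longrightarrow> path_bounded \<tau> (Suc k) s"
  by (auto simp: path_bounded_def)

lemma alt_bounded_Suc: "alt_bounded \<sigma> k \<phi> \<Longrightarrow> alt_bounded \<tau> (Suc k) \<phi>"
  by (auto simp: alt_bounded_def intro: path_bounded_Suc)

lemma alt_bounded_less:
  assumes "alt_bounded \<sigma> i \<phi>" and "i < k"
  shows "alt_bounded \<tau> k \<phi>"
  using assms by (force simp: alt_bounded_def path_bounded_def)

lemma alt_bounded_qfree: "qfree \<phi> \<Longrightarrow> alt_bounded \<sigma> k \<phi>"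
  by (auto simp: alt_bounded_def path_bounded_def Alt_qfree)

lemma alt_bounded_bin [simp]:
  "alt_bounded \<sigma> k (bin f \<phi> \<psi>) \<longleftrightarrow> alt_bounded (left_sign f \<sigma>) k \<phi> \<and> alt_bounded \<sigma> k \<psi>"
  by (cases f) (simp_all add: alt_bounded_def Setcompr_eq_image ball_Un)

lemma Alt_quant:
  "Alt (quant \<sigma> x \<phi>) = (\<lambda>s. if initial s = Some \<sigma> then s else \<sigma> # s) ` Alt \<phi>"
  by (cases \<sigma>) auto

lemma alt_bounded_quant_iff:
  "alt_bounded \<sigma> k (quant \<tau> x \<phi>) \<longleftrightarrow>
    (\<forall>s\<in>Alt \<phi>. path_bounded \<sigma> k (if initial s = Some \<tau> then s else \<tau> # s))"
  unfolding alt_bounded_def Alt_quant by blast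

text \<open>Every path of a quantified formula starts with the sign of the quantifier, so none is
  empty.\<close>

lemma alt_bounded_quant_0 [simp]: "\<not> alt_bounded \<sigma> 0 (quant \<tau> x \<phi>)"
proof -
  obtain s where "s \<in> Alt \<phi>"
    using Alt_nonempty by blast
  moreover have "\<not> path_bounded \<sigma> 0 (if initial s = Some \<tau> then s else \<tau> # s)"
    by (cases s) (auto simp: path_bounded_def)
  ultimately show ?thesis
    using alt_bounded_quant_iff by blast
qed

text \<open>Only paths not starting with \<open>\<sigma>\<close> are extended. For these the bound
  means length at most \<open>k\<close>, which is exactly what leaves room for one more symbol, and
  that symbol is the prescribed one.\<close>

lemma alt_bounded_quant_same [simp]:
  "alt_bounded \<sigma> (Suc k) (quant \<sigma> x \<phi>) \<longleftrightarrow> alt_bounded \<sigma> (Suc k) \<phi>"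
proof -
  have "path_bounded \<sigma> (Suc k) (if initial s = Some \<sigma> then s else \<sigma> # s) \<longleftrightarrow>
      path_bounded \<sigma> (Suc k) s" for s
    by (auto simp: path_bounded_def)
  then show ?thesis
    by (simp only: alt_bounded_quant_iff) (simp only: alt_bounded_def)
qed

text \<open>All paths involved start with \<open>\<sigma>\<close>, so length \<open>Suc k\<close> is
  ruled out on the left, while the sign condition on the right is automatic. The quantifier stays
  while the level drops, which is what drives the inductions on \<open>k\<close> below.\<close>

lemma alt_bounded_quant_flip [simp]:
  "alt_bounded (flip \<sigma>) (Suc k) (quant \<sigma> x \<phi>) \<longleftrightarrow> alt_bounded \<sigma> k (quant \<sigma> x \<phi>)"
proof -
  have "path_bounded (flip \<sigma>) (Suc k) s \<longleftrightarrow> path_bounded \<sigma> k s" if "s \<in> Alt (quant \<sigma> x \<phi>)" for s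
  proof -
    have "initial s = Some \<sigma>"
      using that by (auto simp: Alt_quant split: if_splits)
    then show ?thesis
      by (cases s) (auto simp: path_bounded_def)
  qed
  then show ?thesis
    by (simp add: alt_bounded_def)
qed

lemma alt_bounded_quantD: "alt_bounded \<sigma> k (quant \<tau> x \<phi>) \<Longrightarrow> alt_bounded \<sigma> k \<phi>"
proof (cases k)
  case (Suc j)
  assume b: "alt_bounded \<sigma> k (quant \<tau> x \<phi>)"
  consider "\<tau> = \<sigma>" | "\<tau> = flip \<sigma>"
    using sign_eq_or_flip by blast
  then show ?thesis
  proof cases
    case 2
    then have "alt_bounded \<tau> j (quant \<tau> x \<phi>)"
      using b Suc alt_bounded_quant_flip[of \<tau> j x \<phi>] by simp
    then have "alt_bounded \<tau> j \<phi>"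
      by (cases j) auto
    then show ?thesis
      using Suc alt_bounded_Suc by blast
  qed (use b Suc in auto)
qed auto

text \<open>A bound of sign \<open>flip \<tau>\<close> drops one level to a bound of sign
  \<open>\<tau>\<close>, which passes through to the body; hence the first hypothesis ranges over
  all signs and levels.\<close>

lemma alt_bounded_quant_mono:
  assumes "\<And>\<sigma> k. alt_bounded \<sigma> k \<psi> \<Longrightarrow> alt_bounded \<sigma> k \<phi>"
    and "alt_bounded \<sigma> k (quant \<tau> x \<psi>)"
  shows "alt_bounded \<sigma> k (quant \<tau> x \<phi>)"
  using assms(2)
proof (induction k arbitrary: \<sigma>)
  case (Suc k)
  show ?case
    using sign_eq_or_flip[of \<sigma> \<tau>] Suc assms(1) by auto
qed simp

section \<open>Degree classes as path bounds\<close>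

lemma deg_le_iff: "deg \<phi> \<le> k \<longleftrightarrow> (\<forall>s\<in>Alt \<phi>. length s \<le> k)"
proof -
  have "{length s |s. s \<in> Alt \<phi>} = length ` Alt \<phi>"
    by auto
  then show ?thesis
    by (simp add: deg_def finite_Alt Alt_nonempty)
qed

lemma deg_attained: "\<exists>s\<in>Alt \<phi>. length s = deg \<phi>"
proof -
  have "{length s |s. s \<in> Alt \<phi>} = length ` Alt \<phi>"
    by auto
  then have "deg \<phi> \<in> length ` Alt \<phi>"
    using Max_in[of "length ` Alt \<phi>"] by (simp add: deg_def finite_Alt Alt_nonempty)
  then show ?thesis
    by auto
qed

lemma length_le_deg: "s \<in> Alt \<phi> \<Longrightarrow> length s \<le> deg \<phi>"
  using deg_le_iff by blast

text \<open>The classes \<open>F_cls i\<close> with \<open>i < k\<close> collect the degrees below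
  \<open>k\<close>, where a condition on paths of length \<open>k\<close> is vacuous; so both halves
  of \<open>E_plus k\<close> merge into one bound.\<close>

lemma E_plus_iff: "\<phi> \<in> E_plus k \<longleftrightarrow> alt_bounded Plus k \<phi>"
proof (cases k)
  case 0
  then show ?thesis
    using deg_le_iff[of \<phi> 0]
    by (auto simp: E_plus_def F_cls_def alt_bounded_def path_bounded_def)
next
  case (Suc j)
  have "\<phi> \<in> E_plus k \<longleftrightarrow> deg \<phi> \<le> k \<and> (\<forall>s\<in>Alt \<phi>. length s = k \<longrightarrow> initial s = Some Plus)"
    using Suc by (fastforce simp: E_plus_def F_cls_def dest: length_le_deg)
  with Suc show ?thesis
    unfolding deg_le_iff alt_bounded_def path_bounded_def by (auto simp: le_less)
qed

lemma U_plus_iff: "\<phi> \<in> U_plus k \<longleftrightarrow> alt_bounded Minus k \<phi>"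
proof (cases k)
  case 0
  then show ?thesis
    using deg_le_iff[of \<phi> 0]
    by (auto simp: U_plus_def F_cls_def alt_bounded_def path_bounded_def)
next
  case (Suc j)
  have "\<phi> \<in> U_plus k \<longleftrightarrow> deg \<phi> \<le> k \<and> (\<forall>s\<in>Alt \<phi>. length s = k \<longrightarrow> initial s = Some Minus)"
    using Suc by (fastforce simp: U_plus_def F_cls_def dest: length_le_deg)
  with Suc show ?thesis
    unfolding deg_le_iff alt_bounded_def path_bounded_def by (auto simp: le_less)
qed

text \<open>Under both bounds a path of length \<open>Suc k\<close> would have to start with both
  signs.\<close>

lemma F_plus_eq: "F_plus k = (E_plus (Suc k) \<inter> U_plus (Suc k) :: ('f, 'p) fm set)"
proof -
  have "(\<forall>s\<in>Alt \<phi>. length s \<le> k) \<longleftrightarrow>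
      alt_bounded Plus (Suc k) \<phi> \<and> alt_bounded Minus (Suc k) \<phi>" for \<phi> :: "('f, 'p) fm"
    by (fastforce simp: alt_bounded_def path_bounded_def)
  then show ?thesis
    by (auto simp: F_plus_def deg_le_iff E_plus_iff U_plus_iff)
qed

lemma F_plus_eq_Union: "F_plus k = F_cls k \<union> (\<Union>i<k. F_cls i)"
  by (auto simp: F_plus_def F_cls_def)

lemma EU_cls_subset_F_cls: "E_cls k \<subseteq> F_cls k" "U_cls k \<subseteq> F_cls k"
  by (cases k; auto)+

text \<open>A path of length equal to the degree exists, and it cannot start with both
  signs.\<close>

lemma E_U_cls_disjoint: "E_cls (Suc k) \<inter> U_cls (Suc k) = {}"
  using deg_attained by (fastforce simp: F_cls_def)

lemma F_cls_disjoint: "i < k \<Longrightarrow> F_cls i \<inter> F_cls k = {}"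
  by (auto simp: F_cls_def)

text \<open>The lower classes \<open>F_cls i\<close> lie in both cumulative classes and cancel;
  \<open>E_cls (Suc k)\<close> is disjoint from all that is removed.\<close>

lemma E_cls_eq: "E_cls (Suc k) = E_plus (Suc k) - U_plus (Suc k)"
proof -
  have "(\<Union>i<Suc k. F_cls i) \<inter> F_cls (Suc k) = {}"
    using F_cls_disjoint by blast
  then show ?thesis
    unfolding E_plus_def U_plus_def
    using E_U_cls_disjoint[of k] EU_cls_subset_F_cls[of "Suc k"] by blast
qed

lemma U_cls_eq: "U_cls (Suc k) = U_plus (Suc k) - E_plus (Suc k)"
proof -
  have "(\<Union>i<Suc k. F_cls i) \<inter> F_cls (Suc k) = {}"
    using F_cls_disjoint by blast
  then show ?thesis
    unfolding E_plus_def U_plus_def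
    using E_U_cls_disjoint[of k] EU_cls_subset_F_cls[of "Suc k"] by blast
qed

lemma PF_cls_eq: "PF_cls k = F_plus k - (E_plus k \<union> U_plus k)"
proof -
  have "(\<Union>i<k. F_cls i) \<inter> F_cls k = {}"
    using F_cls_disjoint by blast
  then show ?thesis
    unfolding E_plus_def U_plus_def PF_cls_def F_plus_eq_Union
    using EU_cls_subset_F_cls[of k] by blast
qed


section \<open>Prenex steps\<close>

lemma finite_vars_trm: "finite (vars_trm t)"
  by (induction t) auto

lemma finite_vars_fm: "finite (vars_fm \<phi>)"
  by (induction \<phi>) (auto simp: finite_vars_trm)

lemma FV_subset_vars_fm: "FV \<phi> \<subseteq> vars_fm \<phi>"
  by (induction \<phi>) auto

lemma Alt_subst_fm [simp]: "Alt (subst_fm x y \<phi>) = Alt \<phi>"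
  by (induction \<phi>) auto

lemma alt_bounded_subst_fm [simp]: "alt_bounded \<sigma> k (subst_fm x y \<phi>) \<longleftrightarrow> alt_bounded \<sigma> k \<phi>"
  by (simp add: alt_bounded_def)

lemma qfree_subst_fm [simp]: "qfree (subst_fm x y \<phi>) \<longleftrightarrow> qfree \<phi>"
  by (induction \<phi>) auto

lemma prenex_shape_subst_fm [simp]: "prenex_shape (subst_fm x y \<phi>) \<longleftrightarrow> prenex_shape \<phi>"
  by (induction \<phi>) auto

lemma quant_count_subst_fm [simp]: "quant_count (subst_fm x y \<phi>) = quant_count \<phi>"
  by (induction \<phi>) auto

lemma wf_trm_subst_trm: "wf_trm L t \<Longrightarrow> wf_trm L (subst_trm x y t)"
  by (induction t) auto

lemma wf_fm_subst_fm: "wf_fm L \<phi> \<Longrightarrow> wf_fm L (subst_fm x y \<phi>)"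
  by (induction \<phi>) (auto simp: wf_trm_subst_trm)

lemma wf_fm_rhd_step: "rhd_step \<phi> \<psi> \<Longrightarrow> wf_fm L \<phi> \<Longrightarrow> wf_fm L \<psi>"
  by (induction rule: rhd_step.induct) (auto elim!: rhd.cases simp: wf_fm_subst_fm)

text \<open>Steps preserve well-formedness, so a chain starting in \<open>L\<close> never leaves it,
  and plain step sequences can be used from here on.\<close>

lemma rhd_star_iff:
  assumes "\<phi> \<in> formulas L"
  shows "rhd_star L \<phi> \<psi> \<longleftrightarrow> rhd_step\<^sup>*\<^sup>* \<phi> \<psi>"
proof
  show "rhd_step\<^sup>*\<^sup>* \<phi> \<psi>" if "rhd_star L \<phi> \<psi>"
    using that unfolding rhd_star_def by (rule rtranclp_mono[THEN predicate2D, rotated]) auto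
  assume "rhd_step\<^sup>*\<^sup>* \<phi> \<psi>"
  then have "rhd_star L \<phi> \<psi> \<and> \<psi> \<in> formulas L"
  proof induction
    case base
    then show ?case
      using assms by (simp add: rhd_star_def)
  next
    case (step \<psi> \<chi>)
    then have "\<chi> \<in> formulas L"
      using wf_fm_rhd_step by (auto simp: formulas_def)
    with step show ?case
      unfolding rhd_star_def by (auto intro: rtranclp.rtrancl_into_rtrancl)
  qed
  then show "rhd_star L \<phi> \<psi>" ..
qed

section \<open>Prenex rules in uniform shape\<close>

text \<open>The pulling clauses of \<open>rhd\<close> reduce to two shapes; the two dual clauses for
  an antecedent become one, with the change of quantifier absorbed by
  \<open>left_sign\<close>.\<close>

lemma rhd_uniform_cases:
  assumes "\<phi> \<rhd> \<psi>"
  obtains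
    (pull_left) f \<sigma> x \<xi> \<delta> where "x \<notin> FV \<delta>"
      "\<phi> = bin f (quant (left_sign f \<sigma>) x \<xi>) \<delta>" "\<psi> = quant \<sigma> x (bin f \<xi> \<delta>)"
  | (pull_right) f \<sigma> x \<xi> \<delta> where "x \<notin> FV \<delta>"
      "\<phi> = bin f \<delta> (quant \<sigma> x \<xi>)" "\<psi> = quant \<sigma> x (bin f \<delta> \<xi>)"
  | (rename) \<sigma> x y \<xi> where "y \<notin> vars_fm \<xi>"
      "\<phi> = quant \<sigma> x \<xi>" "\<psi> = quant \<sigma> y (subst_fm x y \<xi>)"
proof -
  have Q: "\<exists>\<sigma>. Q = quant \<sigma>" if "Q \<in> {All, Ex}" for Q :: "nat \<Rightarrow> ('a, 'b) fm \<Rightarrow> ('a, 'b) fm"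
    using that quant.simps by (metis empty_iff insert_iff)
  from assms show thesis
  proof cases
    case (Ex_Imp x \<delta> \<xi>)
    then show ?thesis using pull_left[of x \<delta> OpImp Minus] by simp
  next
    case (All_Imp x \<delta> \<xi>)
    then show ?thesis using pull_left[of x \<delta> OpImp Plus] by simp
  next
    case (Imp_Q Q x \<delta> \<xi>)
    then show ?thesis using pull_right[of x \<delta> OpImp] Q[of Q] by auto
  next
    case (Q_Conj Q x \<delta> \<xi>)
    then show ?thesis using pull_left[of x \<delta> OpConj] Q[of Q] by auto
  next
    case (Conj_Q Q x \<delta> \<xi>)
    then show ?thesis using pull_right[of x \<delta> OpConj] Q[of Q] by auto
  next
    case (Q_Disj Q x \<delta> \<xi>)
    then show ?thesis using pull_left[of x \<delta> OpDisj] Q[of Q] by auto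
  next
    case (Disj_Q Q x \<delta> \<xi>)
    then show ?thesis using pull_right[of x \<delta> OpDisj] Q[of Q] by auto
  next
    case (Q_rename Q y \<xi> x)
    then show ?thesis using rename[of y \<xi>] Q[of Q] by auto
  qed
qed

lemma quant_cases: "quant \<sigma> \<in> {All, Ex}"
  by (cases \<sigma>) auto

lemma rhd_pull_left:
  "x \<notin> FV \<delta> \<Longrightarrow> bin f (quant (left_sign f \<sigma>) x \<xi>) \<delta> \<rhd> quant \<sigma> x (bin f \<xi> \<delta>)"
  by (cases f; cases \<sigma>) (auto intro: rhd.intros)

lemma rhd_pull_right:
  "x \<notin> FV \<delta> \<Longrightarrow> bin f \<delta> (quant \<sigma> x \<xi>) \<rhd> quant \<sigma> x (bin f \<delta> \<xi>)"
  by (cases f; cases \<sigma>) (auto intro: rhd.intros)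

lemma rhd_step_bin_left: "rhd_step \<phi> \<phi>' \<Longrightarrow> rhd_step (bin f \<phi> \<psi>) (bin f \<phi>' \<psi>)"
  by (cases f) (auto intro: rhd_step.intros)

lemma rhd_step_bin_right: "rhd_step \<psi> \<psi>' \<Longrightarrow> rhd_step (bin f \<phi> \<psi>) (bin f \<phi> \<psi>')"
  by (cases f) (auto intro: rhd_step.intros)

lemma rhd_step_quant: "rhd_step \<phi> \<phi>' \<Longrightarrow> rhd_step (quant \<sigma> x \<phi>) (quant \<sigma> x \<phi>')"
  by (cases \<sigma>) (auto intro: rhd_step.intros)

lemma rtranclp_map: "(\<And>x y. R x y \<Longrightarrow> S (h x) (h y)) \<Longrightarrow> R\<^sup>*\<^sup>* x y \<Longrightarrow> S\<^sup>*\<^sup>* (h x) (h y)"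
  by (erule rtranclp_induct) (auto intro: rtranclp.rtrancl_into_rtrancl)

lemma rhd_steps_bin:
  assumes "rhd_step\<^sup>*\<^sup>* \<phi> \<phi>'" and "rhd_step\<^sup>*\<^sup>* \<psi> \<psi>'"
  shows "rhd_step\<^sup>*\<^sup>* (bin f \<phi> \<psi>) (bin f \<phi>' \<psi>')"
proof -
  have "rhd_step\<^sup>*\<^sup>* (bin f \<phi> \<psi>) (bin f \<phi>' \<psi>)"
    by (rule rtranclp_map[OF _ assms(1)]) (rule rhd_step_bin_left)
  also have "rhd_step\<^sup>*\<^sup>* (bin f \<phi>' \<psi>) (bin f \<phi>' \<psi>')"
    by (rule rtranclp_map[OF _ assms(2)]) (rule rhd_step_bin_right)
  finally show ?thesis .
qed

lemma rhd_steps_quant: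
  "rhd_step\<^sup>*\<^sup>* \<phi> \<phi>' \<Longrightarrow> rhd_step\<^sup>*\<^sup>* (quant \<sigma> x \<phi>) (quant \<sigma> x \<phi>')"
  by (erule rtranclp_map[rotated]) (rule rhd_step_quant)

section \<open>Reflection of bounds along prenex steps\<close>

text \<open>For a bound of sign \<open>\<tau>\<close> the quantifier is transparent in either
  position. For the opposite sign the level drops by one, induction applies, and
  \<open>alt_bounded_Suc\<close> returns to the original bound.\<close>

lemma alt_bounded_pull:
  assumes "alt_bounded \<sigma> k (quant \<tau> x (bin f \<xi> \<delta>))"
  shows "alt_bounded \<sigma> k (bin f (quant (left_sign f \<tau>) x \<xi>) \<delta>)"
    and "alt_bounded \<sigma> k (bin f \<xi> (quant \<tau> x \<delta>))"
proof -
  have "alt_bounded \<sigma> k (bin f (quant (left_sign f \<tau>) x \<xi>) \<delta>) \<and>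
      alt_bounded \<sigma> k (bin f \<xi> (quant \<tau> x \<delta>))"
    using assms
  proof (induction k arbitrary: \<sigma>)
    case (Suc k)
    show ?case
      using sign_eq_or_flip[of \<sigma> \<tau>]
    proof
      assume "\<sigma> = \<tau>"
      then show ?thesis using Suc.prems by simp
    next
      assume \<sigma>: "\<sigma> = flip \<tau>"
      then have "alt_bounded \<tau> k (bin f (quant (left_sign f \<tau>) x \<xi>) \<delta>) \<and>
          alt_bounded \<tau> k (bin f \<xi> (quant \<tau> x \<delta>))"
        using Suc by simp
      then show ?thesis using \<sigma> alt_bounded_Suc by blast
    qed
  qed simp
  then show "alt_bounded \<sigma> k (bin f (quant (left_sign f \<tau>) x \<xi>) \<delta>)"
    and "alt_bounded \<sigma> k (bin f \<xi> (quant \<tau> x \<delta>))"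
    by auto
qed

lemma alt_bounded_rhd:
  assumes "\<phi> \<rhd> \<psi>" and "alt_bounded \<sigma> k \<psi>"
  shows "alt_bounded \<sigma> k \<phi>"
  using assms(1)
proof (cases rule: rhd_uniform_cases)
  case (rename \<tau> x y \<xi>)
  then show ?thesis
    using assms(2) by (simp add: alt_bounded_quant_iff)
qed (use assms(2) alt_bounded_pull in blast)+

lemma alt_bounded_connective [simp]:
  "alt_bounded \<sigma> k (Imp \<phi> \<psi>) \<longleftrightarrow> alt_bounded (flip \<sigma>) k \<phi> \<and> alt_bounded \<sigma> k \<psi>"
  "alt_bounded \<sigma> k (Conj \<phi> \<psi>) \<longleftrightarrow> alt_bounded \<sigma> k \<phi> \<and> alt_bounded \<sigma> k \<psi>"
  "alt_bounded \<sigma> k (Disj \<phi> \<psi>) \<longleftrightarrow> alt_bounded \<sigma> k \<phi> \<and> alt_bounded \<sigma> k \<psi>"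
  using alt_bounded_bin[of \<sigma> k OpImp] alt_bounded_bin[of \<sigma> k OpConj]
    alt_bounded_bin[of \<sigma> k OpDisj] by simp_all

lemma alt_bounded_rhd_step: "rhd_step \<phi> \<psi> \<Longrightarrow> alt_bounded \<sigma> k \<psi> \<Longrightarrow> alt_bounded \<sigma> k \<phi>"
\<comment> \<open>The sign varies because a step in an antecedent is seen with the opposite sign;
  sign and level both vary for steps under a quantifier.\<close>
proof (induction arbitrary: \<sigma> k rule: rhd_step.induct)
  case (here \<phi> \<psi>)
  then show ?case by (rule alt_bounded_rhd)
next
  case (All_body \<phi> \<phi>' x)
  then show ?case using alt_bounded_quant_mono[of \<phi>' \<phi> \<sigma> k Minus x] by simp
next
  case (Ex_body \<phi> \<phi>' x)
  then show ?case using alt_bounded_quant_mono[of \<phi>' \<phi> \<sigma> k Plus x] by simp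
qed auto

lemma alt_bounded_rhd_steps: "rhd_step\<^sup>*\<^sup>* \<phi> \<psi> \<Longrightarrow> alt_bounded \<sigma> k \<psi> \<Longrightarrow> alt_bounded \<sigma> k \<phi>"
  by (induction rule: converse_rtranclp_induct) (auto intro: alt_bounded_rhd_step)


section \<open>Prenex formulas of bounded alternation\<close>

lemma qfree_imp_prenex_shape: "qfree \<phi> \<Longrightarrow> prenex_shape \<phi>"
  by (cases \<phi>) auto

lemma qfree_bin [simp]: "qfree (bin f \<phi> \<psi>) \<longleftrightarrow> qfree \<phi> \<and> qfree \<psi>"
  by (cases f) auto

lemma prenex_shape_quant [simp]: "prenex_shape (quant \<sigma> x \<phi>) \<longleftrightarrow> prenex_shape \<phi>"
  by (cases \<sigma>) auto

lemma quant_count_quant [simp]: "quant_count (quant \<sigma> x \<phi>) = Suc (quant_count \<phi>)"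
  by (cases \<sigma>) auto

lemma prenex_shape_cases:
  assumes "prenex_shape \<phi>"
  obtains (qfree) "qfree \<phi>"
  | (quant) \<sigma> x \<psi> where "\<phi> = quant \<sigma> x \<psi>" "prenex_shape \<psi>"
proof (cases \<phi>)
  case (All x \<psi>)
  then show ?thesis using quant[of Minus] assms by simp
next
  case (Ex x \<psi>)
  then show ?thesis using quant[of Plus] assms by simp
qed (use assms qfree in simp_all)

text \<open>\<open>V\<close> will be the variables of the other operand, so that the side condition
  of the pulling rules holds for \<open>y\<close>.\<close>

lemma quant_fresh:
  assumes "finite V"
  obtains y where "y \<notin> V" "rhd_step (quant \<sigma> x \<phi>) (quant \<sigma> y (subst_fm x y \<phi>))"
proof -
  obtain y where "y \<notin> V \<union> vars_fm \<phi>"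
    using ex_new_if_finite[of "V \<union> vars_fm \<phi>"] assms finite_vars_fm by auto
  then show thesis
    using that Q_rename[OF quant_cases, of y \<phi> \<sigma> x] by (auto intro: rhd_step.here)
qed

section \<open>Greedy extraction of quantifiers\<close>

text \<open>Pulling a quantifier out as \<open>\<sigma>\<close> leaves a bound of sign
  \<open>\<sigma>\<close> intact. Once neither operand offers one, each is quantifier-free or starts
  with the opposite kind, so both satisfy the bound of sign \<open>flip \<sigma>\<close> one level
  lower and extraction goes on there.\<close>

lemma bin_prenex:
  assumes "prenex_shape \<phi>" "prenex_shape \<psi>"
    and "alt_bounded (left_sign f \<sigma>) k \<phi>" "alt_bounded \<sigma> k \<psi>"
  shows "\<exists>\<chi>. rhd_step\<^sup>*\<^sup>* (bin f \<phi> \<psi>) \<chi> \<and> prenex_shape \<chi> \<and> alt_bounded \<sigma> k \<chi>"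
  using assms
proof (induction "quant_count \<phi> + quant_count \<psi>" arbitrary: \<phi> \<psi> \<sigma> k rule: less_induct)
  case less
  \<comment> \<open>Sign and level are arbitrary here and in \<open>pull_right\<close>, since both
    claims are also applied to \<open>flip \<sigma>\<close> one level lower.\<close>
  have pull_left: "\<exists>\<chi>. rhd_step\<^sup>*\<^sup>* (bin f \<phi> \<psi>) \<chi> \<and> prenex_shape \<chi> \<and> alt_bounded \<sigma> k \<chi>"
    if b: "alt_bounded (left_sign f \<sigma>) k \<phi>" "alt_bounded \<sigma> k \<psi>"
      and eq: "\<phi> = quant (left_sign f \<sigma>) x \<xi>" for \<sigma> k x \<xi>
  proof -
    obtain y where y: "y \<notin> vars_fm \<psi>"
        "rhd_step \<phi> (quant (left_sign f \<sigma>) y (subst_fm x y \<xi>))"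
      using quant_fresh[OF finite_vars_fm] eq by metis
    have "rhd_step (bin f \<phi> \<psi>) (bin f (quant (left_sign f \<sigma>) y (subst_fm x y \<xi>)) \<psi>)"
      using y(2) by (rule rhd_step_bin_left)
    moreover have "rhd_step (bin f (quant (left_sign f \<sigma>) y (subst_fm x y \<xi>)) \<psi>)
        (quant \<sigma> y (bin f (subst_fm x y \<xi>) \<psi>))"
      using y(1) FV_subset_vars_fm by (blast intro: rhd_step.here rhd_pull_left)
    \<comment> \<open>Induction hypothesis: one quantifier has been removed, and renaming does not
      change the count.\<close>
    moreover obtain \<chi> where \<chi>: "rhd_step\<^sup>*\<^sup>* (bin f (subst_fm x y \<xi>) \<psi>) \<chi>"
        "prenex_shape \<chi>" "alt_bounded \<sigma> k \<chi>"
      using less.hyps[of "subst_fm x y \<xi>" \<psi> \<sigma> k] less.prems(1,2) b eq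
        alt_bounded_quantD[of _ k _ x \<xi>] by auto
    ultimately have "rhd_step\<^sup>*\<^sup>* (bin f \<phi> \<psi>) (quant \<sigma> y \<chi>)"
      using rhd_steps_quant[OF \<chi>(1)] by (meson converse_rtranclp_into_rtranclp)
    \<comment> \<open>Level 0 is impossible because \<open>\<phi>\<close> is quantified; at a
      successor level the new outer quantifier is transparent.\<close>
    moreover have "alt_bounded \<sigma> k (quant \<sigma> y \<chi>)"
      using \<chi>(3) b(1) eq by (cases k) auto
    ultimately show ?thesis
      using \<chi>(2) prenex_shape_quant by blast
  qed
  have pull_right: "\<exists>\<chi>. rhd_step\<^sup>*\<^sup>* (bin f \<phi> \<psi>) \<chi> \<and> prenex_shape \<chi> \<and> alt_bounded \<sigma> k \<chi>"
    if b: "alt_bounded (left_sign f \<sigma>) k \<phi>" "alt_bounded \<sigma> k \<psi>"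
      and eq: "\<psi> = quant \<sigma> x \<xi>" for \<sigma> k x \<xi>
  proof -
    obtain y where y: "y \<notin> vars_fm \<phi>" "rhd_step \<psi> (quant \<sigma> y (subst_fm x y \<xi>))"
      using quant_fresh[OF finite_vars_fm] eq by metis
    have "rhd_step (bin f \<phi> \<psi>) (bin f \<phi> (quant \<sigma> y (subst_fm x y \<xi>)))"
      using y(2) by (rule rhd_step_bin_right)
    moreover have "rhd_step (bin f \<phi> (quant \<sigma> y (subst_fm x y \<xi>)))
        (quant \<sigma> y (bin f \<phi> (subst_fm x y \<xi>)))"
      using y(1) FV_subset_vars_fm by (blast intro: rhd_step.here rhd_pull_right)
    moreover obtain \<chi> where \<chi>: "rhd_step\<^sup>*\<^sup>* (bin f \<phi> (subst_fm x y \<xi>)) \<chi>"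
        "prenex_shape \<chi>" "alt_bounded \<sigma> k \<chi>"
      using less.hyps[of \<phi> "subst_fm x y \<xi>" \<sigma> k] less.prems(1,2) b eq
        alt_bounded_quantD[of _ k _ x \<xi>] by auto
    ultimately have "rhd_step\<^sup>*\<^sup>* (bin f \<phi> \<psi>) (quant \<sigma> y \<chi>)"
      using rhd_steps_quant[OF \<chi>(1)] by (meson converse_rtranclp_into_rtranclp)
    moreover have "alt_bounded \<sigma> k (quant \<sigma> y \<chi>)"
      using \<chi>(3) b(2) eq by (cases k) auto
    ultimately show ?thesis
      using \<chi>(2) prenex_shape_quant by blast
  qed
  \<comment> \<open>A leading quantifier of the opposite kind forces a positive level and allows
    lowering it by one.\<close>
  have lower: "\<exists>j. k = Suc j \<and> alt_bounded (flip \<tau>) j \<xi>"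
    if "alt_bounded \<tau> k \<xi>" "\<xi> = quant (flip \<tau>) x \<xi>'" for \<tau> x and \<xi> \<xi>' :: "('a, 'b) fm"
    using that alt_bounded_quant_flip[of "flip \<tau>"] by (cases k) auto
  have shape: "qfree \<xi> \<or> (\<exists>x \<xi>'. \<xi> = quant \<tau> x \<xi>') \<or> (\<exists>x \<xi>'. \<xi> = quant (flip \<tau>) x \<xi>')"
    if "prenex_shape \<xi>" for \<tau> and \<xi> :: "('a, 'b) fm"
    using that by (cases rule: prenex_shape_cases) (blast, metis sign_eq_or_flip)
  consider (here) "(\<exists>x \<xi>. \<phi> = quant (left_sign f \<sigma>) x \<xi>) \<or> (\<exists>x \<xi>. \<psi> = quant \<sigma> x \<xi>)"
    | (qfree) "qfree \<phi>" "qfree \<psi>"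
    | (left) x \<xi> where "\<phi> = quant (flip (left_sign f \<sigma>)) x \<xi>"
        "qfree \<psi> \<or> (\<exists>x \<xi>. \<psi> = quant (flip \<sigma>) x \<xi>)"
    | (right) x \<xi> where "qfree \<phi>" "\<psi> = quant (flip \<sigma>) x \<xi>"
    using shape[OF less.prems(1), of "left_sign f \<sigma>"] shape[OF less.prems(2), of \<sigma>] by blast
  then show ?case
  proof cases
    case here
    then show ?thesis
      using pull_left pull_right less.prems(3,4) by blast
  next
    case qfree
    then show ?thesis
      using less.prems(3,4)
      by (intro exI[of _ "bin f \<phi> \<psi>"]) (auto intro: qfree_imp_prenex_shape)
  next
    case left
    obtain j where j: "k = Suc j" "alt_bounded (left_sign f (flip \<sigma>)) j \<phi>"
      using lower[OF less.prems(3) left(1)] by (auto simp: left_sign_flip)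
    \<comment> \<open>A quantifier-free \<open>\<psi>\<close> is bounded at every level; otherwise
      \<open>lower\<close> applies to it as well, with the same \<open>j\<close>.\<close>
    moreover have "alt_bounded (flip \<sigma>) j \<psi>"
      using left(2) lower[OF less.prems(4)] j(1) by (auto intro: alt_bounded_qfree)
    ultimately show ?thesis
      using pull_left[of "flip \<sigma>" j x \<xi>] left(1) alt_bounded_Suc by (metis left_sign_flip)
  next
    case right
    obtain j where j: "k = Suc j" "alt_bounded (flip \<sigma>) j \<psi>"
      using lower[OF less.prems(4) right(2)] by auto
    then show ?thesis
      using pull_right[of "flip \<sigma>" j x \<xi>] right alt_bounded_Suc alt_bounded_qfree by metis
  qed
qed

text \<open>The quantifier stays in front and only its body is transformed. If its sign is not
  \<open>\<sigma>\<close>, the whole formula is already bounded with sign \<open>\<tau>\<close> one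
  level lower, and a witness for that bound also meets the original one.\<close>

lemma quant_prenex:
  assumes "\<And>\<sigma> k. alt_bounded \<sigma> k \<phi> \<Longrightarrow>
      \<exists>\<chi>. rhd_step\<^sup>*\<^sup>* \<phi> \<chi> \<and> prenex_shape \<chi> \<and> alt_bounded \<sigma> k \<chi>"
    and "alt_bounded \<sigma> k (quant \<tau> x \<phi>)"
  shows "\<exists>\<chi>. rhd_step\<^sup>*\<^sup>* (quant \<tau> x \<phi>) \<chi> \<and> prenex_shape \<chi> \<and> alt_bounded \<sigma> k \<chi>"
  using assms(2)
proof (induction k arbitrary: \<sigma>)
  case (Suc k)
  show ?case
    using sign_eq_or_flip[of \<sigma> \<tau>]
  proof
    assume "\<sigma> = \<tau>"
    then obtain \<chi> where "rhd_step\<^sup>*\<^sup>* \<phi> \<chi>" "prenex_shape \<chi>" "alt_bounded \<sigma> (Suc k) \<chi>"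
      using Suc.prems assms(1) by auto
    then show ?thesis
      using \<open>\<sigma> = \<tau>\<close> by (intro exI[of _ "quant \<tau> x \<chi>"]) (auto intro: rhd_steps_quant)
  next
    assume "\<sigma> = flip \<tau>"
    then show ?thesis
      using Suc alt_bounded_quant_flip alt_bounded_Suc by metis
  qed
qed simp

text \<open>Both operands of a connective are first made prenex, each under its own sign, and then
  merged by \<open>bin_prenex\<close>.\<close>

lemma alt_bounded_imp_prenex:
  "alt_bounded \<sigma> k \<phi> \<Longrightarrow> \<exists>\<chi>. rhd_step\<^sup>*\<^sup>* \<phi> \<chi> \<and> prenex_shape \<chi> \<and> alt_bounded \<sigma> k \<chi>"
proof (induction \<phi> arbitrary: \<sigma> k)
  case Bot
  then show ?case by (intro exI[of _ Bot]) auto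
next
  case (Rel p ts)
  then show ?case by (intro exI[of _ "Rel p ts"]) auto
next
  case (Imp \<phi> \<psi>)
  then obtain \<phi>' \<psi>' where *: "rhd_step\<^sup>*\<^sup>* \<phi> \<phi>'" "prenex_shape \<phi>'" "alt_bounded (flip \<sigma>) k \<phi>'"
      "rhd_step\<^sup>*\<^sup>* \<psi> \<psi>'" "prenex_shape \<psi>'" "alt_bounded \<sigma> k \<psi>'"
    by (metis alt_bounded_connective(1))
  then show ?case
    using bin_prenex[of \<phi>' \<psi>' OpImp \<sigma> k] rhd_steps_bin[OF *(1,4), of OpImp]
    by (auto intro: rtranclp_trans)
next
  case (Conj \<phi> \<psi>)
  then obtain \<phi>' \<psi>' where *: "rhd_step\<^sup>*\<^sup>* \<phi> \<phi>'" "prenex_shape \<phi>'" "alt_bounded \<sigma> k \<phi>'"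
      "rhd_step\<^sup>*\<^sup>* \<psi> \<psi>'" "prenex_shape \<psi>'" "alt_bounded \<sigma> k \<psi>'"
    by (metis alt_bounded_connective(2))
  then show ?case
    using bin_prenex[of \<phi>' \<psi>' OpConj \<sigma> k] rhd_steps_bin[OF *(1,4), of OpConj]
    by (auto intro: rtranclp_trans)
next
  case (Disj \<phi> \<psi>)
  then obtain \<phi>' \<psi>' where *: "rhd_step\<^sup>*\<^sup>* \<phi> \<phi>'" "prenex_shape \<phi>'" "alt_bounded \<sigma> k \<phi>'"
      "rhd_step\<^sup>*\<^sup>* \<psi> \<psi>'" "prenex_shape \<psi>'" "alt_bounded \<sigma> k \<psi>'"
    by (metis alt_bounded_connective(3))
  then show ?case
    using bin_prenex[of \<phi>' \<psi>' OpDisj \<sigma> k] rhd_steps_bin[OF *(1,4), of OpDisj]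
    by (auto intro: rtranclp_trans)
next
  case (All x \<phi>)
  then show ?case using quant_prenex[of \<phi> \<sigma> k Minus x] by simp
next
  case (Ex x \<phi>)
  then show ?case using quant_prenex[of \<phi> \<sigma> k Plus x] by simp
qed

section \<open>The classes of prenex formulas as path bounds\<close>

fun prefix_cls :: "sign \<Rightarrow> nat \<Rightarrow> ('f, 'p) fm set" where
  "prefix_cls Plus k = Sigma_cls k"
| "prefix_cls Minus k = Pi_cls k"

definition prefix_plus :: "sign \<Rightarrow> nat \<Rightarrow> ('f, 'p) fm set" where
  "prefix_plus \<sigma> k = prefix_cls \<sigma> k \<union> (\<Union>i<k. \<Union>\<tau>. prefix_cls \<tau> i)"

lemma UN_sign: "(\<Union>\<tau>. prefix_cls \<tau> i) = Sigma_cls i \<union> Pi_cls i"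
proof -
  have UNIV_sign: "(UNIV :: sign set) = {Plus, Minus}"
    using sign.exhaust by auto
  show ?thesis unfolding UNIV_sign by simp
qed

lemma Sigma_plus_eq: "Sigma_plus k = prefix_plus Plus k"
  and Pi_plus_eq: "Pi_plus k = prefix_plus Minus k"
  by (simp_all add: Sigma_plus_def Pi_plus_def prefix_plus_def UN_sign)

lemma prefix_cls_0: "prefix_cls \<sigma> 0 = {\<phi>. qfree \<phi>}"
  by (cases \<sigma>) auto

lemma prefix_cls_Suc:
  "prefix_cls \<sigma> (Suc k) = {foldr (quant \<sigma>) xs \<phi> |xs \<phi>. xs \<noteq> [] \<and> \<phi> \<in> prefix_cls (flip \<sigma>) k}"
  by (cases \<sigma>) auto

lemma quant_prefix_cls_same:
  assumes "\<phi> \<in> prefix_cls \<sigma> (Suc k)"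
  shows "quant \<sigma> x \<phi> \<in> prefix_cls \<sigma> (Suc k)"
proof -
  obtain xs \<psi> where "\<phi> = foldr (quant \<sigma>) xs \<psi>" "\<psi> \<in> prefix_cls (flip \<sigma>) k"
    using assms by (auto simp: prefix_cls_Suc)
  then show ?thesis
    unfolding prefix_cls_Suc by (intro CollectI exI[of _ "x # xs"] exI[of _ \<psi>]) simp
qed

lemma quant_prefix_cls_flip:
  assumes "\<phi> \<in> prefix_cls (flip \<sigma>) k"
  shows "quant \<sigma> x \<phi> \<in> prefix_cls \<sigma> (Suc k)"
  unfolding prefix_cls_Suc using assms by (intro CollectI exI[of _ "[x]"] exI[of _ \<phi>]) simp

lemma prefix_cls_imp:
  "\<phi> \<in> prefix_cls \<sigma> k \<Longrightarrow> prenex_shape \<phi> \<and> alt_bounded \<sigma> k \<phi>"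
proof (induction k arbitrary: \<phi> \<sigma>)
  case 0
  then show ?case
    by (simp add: prefix_cls_0 qfree_imp_prenex_shape alt_bounded_qfree)
next
  case (Suc k)
  then obtain xs \<psi> where \<phi>: "\<phi> = foldr (quant \<sigma>) xs \<psi>" and \<psi>: "\<psi> \<in> prefix_cls (flip \<sigma>) k"
    by (auto simp: prefix_cls_Suc)
  \<comment> \<open>Raising the level by one absorbs the change of sign between
    \<open>\<psi>\<close> and the block in front of it.\<close>
  have "prenex_shape \<psi>" "alt_bounded \<sigma> (Suc k) \<psi>"
    using Suc.IH[OF \<psi>] alt_bounded_Suc by blast+
  then show ?case
    unfolding \<phi> by (induction xs) auto
qed

lemma quant_prefix_plus:
  assumes "\<phi> \<in> prefix_plus \<sigma> (Suc k)"
  shows "quant \<sigma> x \<phi> \<in> prefix_plus \<sigma> (Suc k)"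
proof -
  \<comment> \<open>A quantifier in front of a formula of the opposite class opens a new block at
    level \<open>Suc i\<close>, which is the top class or a lower one.\<close>
  have cls: "quant \<sigma> x \<phi> \<in> prefix_plus \<sigma> (Suc k)" if "\<phi> \<in> prefix_cls (flip \<sigma>) i" "i \<le> k" for i
    using quant_prefix_cls_flip[OF that(1), of x] that(2)
    by (cases "i = k") (auto simp: prefix_plus_def)
  consider "\<phi> \<in> prefix_cls \<sigma> (Suc k)" | i \<tau> where "i \<le> k" "\<phi> \<in> prefix_cls \<tau> i"
    using assms by (auto simp: prefix_plus_def less_Suc_eq_le)
  then show ?thesis
  proof cases
    case 1
    then show ?thesis
      by (simp add: prefix_plus_def quant_prefix_cls_same)
  next
    case 2
    show ?thesis
      using sign_eq_or_flip[of \<tau> \<sigma>]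
    proof
      assume "\<tau> = \<sigma>"
      show ?thesis
      proof (cases i)
        case 0
        \<comment> \<open>At level 0 there is no block to extend, but the class does not depend on
          the sign, so \<open>\<phi>\<close> also counts as a member of the opposite one.\<close>
        then show ?thesis using cls[of 0] 2 by (simp add: prefix_cls_0)
      next
        case (Suc j)
        then have "quant \<sigma> x \<phi> \<in> prefix_cls \<sigma> i"
          using 2 \<open>\<tau> = \<sigma>\<close> quant_prefix_cls_same by blast
        then show ?thesis using 2(1) by (auto simp: prefix_plus_def less_Suc_eq_le)
      qed
    qed (use cls 2 in blast)
  qed
qed

lemma prefix_plus_Suc: "prefix_plus \<sigma> k \<subseteq> prefix_plus \<tau> (Suc k)"
  by (auto simp: prefix_plus_def less_Suc_eq)

text \<open>For the converse, the leading quantifier is removed if its sign is the prescribed one;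
  if not, the bound first drops to its own sign one level lower, and the inclusion
  \<open>prefix_plus_Suc\<close> leads back.\<close>

lemma prefix_plus_iff: "\<phi> \<in> prefix_plus \<sigma> k \<longleftrightarrow> prenex_shape \<phi> \<and> alt_bounded \<sigma> k \<phi>"
proof
  show "prenex_shape \<phi> \<and> alt_bounded \<sigma> k \<phi>" if "\<phi> \<in> prefix_plus \<sigma> k"
    using that alt_bounded_less by (fastforce simp: prefix_plus_def dest: prefix_cls_imp)
  have "\<phi> \<in> prefix_plus \<sigma> k" if "prenex_shape \<phi>" "alt_bounded \<sigma> k \<phi>"
    using that
  proof (induction "quant_count \<phi>" arbitrary: \<phi> \<sigma> k rule: less_induct)
    case less
    from less.prems(1) show ?case
    proof (cases rule: prenex_shape_cases)
      case qfree
      then have "\<phi> \<in> prefix_cls \<sigma> 0"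
        by (simp add: prefix_cls_0)
      then show ?thesis
        by (cases k) (auto simp: prefix_plus_def)
    next
      case (quant \<tau> x \<psi>)
      have same: "\<phi> \<in> prefix_plus \<tau> (Suc j)" if "alt_bounded \<tau> (Suc j) \<phi>" for j
        using that less.hyps[of \<psi> \<tau> "Suc j"] quant quant_prefix_plus by simp
      obtain j where k: "k = Suc j"
        using less.prems(2) quant(1) by (cases k) auto
      show ?thesis
        using sign_eq_or_flip[of \<sigma> \<tau>]
      proof
        assume "\<sigma> = flip \<tau>"
        then have b: "alt_bounded \<tau> j \<phi>"
          using less.prems(2) quant(1) k by simp
        then obtain i where "j = Suc i"
          using quant(1) by (cases j) auto
        then show ?thesis
          using same b k prefix_plus_Suc by blast
      qed (use same less.prems(2) k in simp)
    qed
  qed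
  then show "\<phi> \<in> prefix_plus \<sigma> k" if "prenex_shape \<phi> \<and> alt_bounded \<sigma> k \<phi>"
    using that by blast
qed

lemma prenex_prefix_plus: "\<phi> \<in> prefix_plus \<sigma> k \<Longrightarrow> prenex \<phi>"
  unfolding prenex_def prefix_plus_def UN_sign by (cases \<sigma>) auto

section \<open>Path bounds and prenex normal forms\<close>

lemma alt_bounded_iff_PNF:
  assumes "\<phi> \<in> formulas L"
  shows "alt_bounded \<sigma> k \<phi> \<longleftrightarrow> PNF L \<phi> \<inter> prefix_plus \<sigma> k \<noteq> {}"
proof
  assume "alt_bounded \<sigma> k \<phi>"
  then obtain \<chi> where "rhd_step\<^sup>*\<^sup>* \<phi> \<chi>" "\<chi> \<in> prefix_plus \<sigma> k"
    using alt_bounded_imp_prenex prefix_plus_iff by blast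
  then show "PNF L \<phi> \<inter> prefix_plus \<sigma> k \<noteq> {}"
    using prenex_prefix_plus by (auto simp: PNF_def rhd_star_iff[OF assms])
next
  assume "PNF L \<phi> \<inter> prefix_plus \<sigma> k \<noteq> {}"
  then show "alt_bounded \<sigma> k \<phi>"
    by (auto simp: PNF_def rhd_star_iff[OF assms] prefix_plus_iff intro: alt_bounded_rhd_steps)
qed

theorem theorem4p8:
  fixes L :: "('f, 'p) language" and k :: nat and \<phi> :: "('f, 'p) fm"
  assumes "\<phi> \<in> formulas L"
  shows
    "(\<phi> \<in> E_plus k \<longleftrightarrow> PNF L \<phi> \<inter> Sigma_plus k \<noteq> {}) \<and>
     (\<phi> \<in> U_plus k \<longleftrightarrow> PNF L \<phi> \<inter> Pi_plus k \<noteq> {}) \<and>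
     (\<phi> \<in> F_plus k \<longleftrightarrow>
        PNF L \<phi> \<inter> Sigma_plus (k + 1) \<noteq> {} \<and> PNF L \<phi> \<inter> Pi_plus (k + 1) \<noteq> {}) \<and>
     ((\<phi> \<in> E_cls (k + 1) \<longleftrightarrow>
        PNF L \<phi> \<inter> Sigma_plus (k + 1) \<noteq> {} \<and> PNF L \<phi> \<inter> Pi_plus (k + 1) = {}) \<and>
      (\<phi> \<in> E_cls (k + 1) \<longleftrightarrow>
        PNF L \<phi> \<inter> Sigma_cls (k + 1) \<noteq> {} \<and> PNF L \<phi> \<inter> Pi_plus (k + 1) = {})) \<and>
     ((\<phi> \<in> U_cls (k + 1) \<longleftrightarrow>
        PNF L \<phi> \<inter> Pi_plus (k + 1) \<noteq> {} \<and> PNF L \<phi> \<inter> Sigma_plus (k + 1) = {}) \<and>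
      (\<phi> \<in> U_cls (k + 1) \<longleftrightarrow>
        PNF L \<phi> \<inter> Pi_cls (k + 1) \<noteq> {} \<and> PNF L \<phi> \<inter> Sigma_plus (k + 1) = {})) \<and>
     ((\<phi> \<in> PF_cls k \<longleftrightarrow>
        PNF L \<phi> \<inter> Sigma_plus (k + 1) \<noteq> {} \<and> PNF L \<phi> \<inter> Pi_plus (k + 1) \<noteq> {} \<and>
        PNF L \<phi> \<inter> (Sigma_plus k \<union> Pi_plus k) = {}) \<and>
      (\<phi> \<in> PF_cls k \<longleftrightarrow>
        PNF L \<phi> \<inter> Sigma_cls (k + 1) \<noteq> {} \<and> PNF L \<phi> \<inter> Pi_cls (k + 1) \<noteq> {} \<and>
        PNF L \<phi> \<inter> (Sigma_plus k \<union> Pi_plus k) = {}))"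
proof -
  have E: "\<phi> \<in> E_plus j \<longleftrightarrow> PNF L \<phi> \<inter> Sigma_plus j \<noteq> {}" for j
    by (simp add: E_plus_iff Sigma_plus_eq alt_bounded_iff_PNF[OF assms])
  have U: "\<phi> \<in> U_plus j \<longleftrightarrow> PNF L \<phi> \<inter> Pi_plus j \<noteq> {}" for j
    by (simp add: U_plus_iff Pi_plus_eq alt_bounded_iff_PNF[OF assms])
  have F: "\<phi> \<in> F_plus k \<longleftrightarrow>
      PNF L \<phi> \<inter> Sigma_plus (k + 1) \<noteq> {} \<and> PNF L \<phi> \<inter> Pi_plus (k + 1) \<noteq> {}"
    using E[of "k + 1"] U[of "k + 1"] by (simp add: F_plus_eq)
  have E4: "\<phi> \<in> E_cls (k + 1) \<longleftrightarrow>
      PNF L \<phi> \<inter> Sigma_plus (k + 1) \<noteq> {} \<and> PNF L \<phi> \<inter> Pi_plus (k + 1) = {}"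
    using E[of "k + 1"] U[of "k + 1"] by (simp add: E_cls_eq del: E_cls.simps)
  have U5: "\<phi> \<in> U_cls (k + 1) \<longleftrightarrow>
      PNF L \<phi> \<inter> Pi_plus (k + 1) \<noteq> {} \<and> PNF L \<phi> \<inter> Sigma_plus (k + 1) = {}"
    using E[of "k + 1"] U[of "k + 1"] by (simp add: U_cls_eq del: U_cls.simps)
  have PF6: "\<phi> \<in> PF_cls k \<longleftrightarrow>
      PNF L \<phi> \<inter> Sigma_plus (k + 1) \<noteq> {} \<and> PNF L \<phi> \<inter> Pi_plus (k + 1) \<noteq> {} \<and>
      PNF L \<phi> \<inter> (Sigma_plus k \<union> Pi_plus k) = {}"
    using E[of k] U[of k] F by (simp add: PF_cls_eq Int_Un_distrib)
  \<comment> \<open>The classes below level \<open>k + 1\<close> are exactly those gathered in the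
    two cumulative classes of level \<open>k\<close>.\<close>
  have Sigma: "Sigma_plus (k + 1) = Sigma_cls (k + 1) \<union> (Sigma_plus k \<union> Pi_plus k)"
    and Pi: "Pi_plus (k + 1) = Pi_cls (k + 1) \<union> (Sigma_plus k \<union> Pi_plus k)"
    unfolding Sigma_plus_def Pi_plus_def Suc_eq_plus1[symmetric] lessThan_Suc by auto
  \<comment> \<open>\<open>Pi_plus (k + 1)\<close> contains all lower classes, so if no normal form
    lies in it, any witness in \<open>Sigma_plus (k + 1)\<close> is in the top class.\<close>
  have E4': "\<phi> \<in> E_cls (k + 1) \<longleftrightarrow>
      PNF L \<phi> \<inter> Sigma_cls (k + 1) \<noteq> {} \<and> PNF L \<phi> \<inter> Pi_plus (k + 1) = {}"
    unfolding E4 Sigma Pi by blast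
  have U5': "\<phi> \<in> U_cls (k + 1) \<longleftrightarrow>
      PNF L \<phi> \<inter> Pi_cls (k + 1) \<noteq> {} \<and> PNF L \<phi> \<inter> Sigma_plus (k + 1) = {}"
    unfolding U5 Sigma Pi by blast
  \<comment> \<open>Here the last conjunct excludes the lower classes directly.\<close>
  have PF6': "\<phi> \<in> PF_cls k \<longleftrightarrow>
      PNF L \<phi> \<inter> Sigma_cls (k + 1) \<noteq> {} \<and> PNF L \<phi> \<inter> Pi_cls (k + 1) \<noteq> {} \<and>
      PNF L \<phi> \<inter> (Sigma_plus k \<union> Pi_plus k) = {}"
    unfolding PF6 Sigma Pi by blast
  show ?thesis
    by (intro conjI) (fact E U F E4 E4' U5 U5' PF6 PF6')+
qed

end
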